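(* Let $r\ge2$ be an integer. For a strictly increasing sequence $v_1<v_2<\cdots$ of positive integers, let $i_n$ be the number of base-$r$ digits of $v_n$ and, for a digit $j\in\{0,\dots,r-1\}$, let $l_{i_n j}$ be the number of occurrences of $j$ in the base-$r$ expansion of $v_n$; call the sequence irregular if for some $j\in\{1,2,\dots,r-1\}$ the limit $\lim_{n\to\infty} l_{i_n j}/i_n$ does not exist. Then irregular sequences exist. Moreover, if $r>2$, there exist irregular sequences $\{v_n\}$ with $\sum_n \frac1{v_n}<\infty$, and there exist irregular sequences $\{v_n\}$ with $\sum_n\frac1{v_n}=\infty$. *)

theory Defs
  imports Complex_Main "HOL-Library.Log_Nat"
begin

text \<open>
  For \<open>r \<ge> 2\<close> and \<open>v > 0\<close>, the base-\<open>r\<close> expansion of \<open>v\<close> without leading zeros has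
  \<^term>\<open>floorlog r v\<close> digits, the one at place \<open>k\<close> (the coefficient of \<open>r ^ k\<close>)
  being \<open>(v div r ^ k) mod r\<close>.
\<close>

definition digit_count :: "nat \<Rightarrow> nat \<Rightarrow> nat \<Rightarrow> nat" where
  "digit_count r j v = card {k. k < floorlog r v \<and> (v div r ^ k) mod r = j}"

text \<open>Sequences are indexed from 0, so \<open>v n\<close> is the term usually written \<open>v\<^sub>n\<^sub>+\<^sub>1\<close>.\<close>

definition irregular :: "nat \<Rightarrow> (nat \<Rightarrow> nat) \<Rightarrow> bool" where
  "irregular r v \<longleftrightarrow>
     strict_mono v \<and> (\<forall>n. v n > 0) \<and>
     (\<exists>j\<in>{1..r - 1}.
        \<not> convergent (\<lambda>n. real (digit_count r j (v n)) / real (floorlog r (v n))))"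

end

theory Submission
  imports Defs "HOL-Analysis.Harmonic_Numbers"
begin

text \<open>
  The digit 1 has frequency \<open>1 / (n + 1)\<close> in \<open>r ^ n\<close> and frequency 1 in the repunit with
  \<open>n + 1\<close> digits.  Alternating between the two gives an irregular sequence which grows like \<open>r ^ n\<close>,
  so its reciprocals are summable.  It is a subsequence of the sequence of all positive integers,
  which is therefore irregular as well, and whose reciprocals form the harmonic series.
\<close>

text \<open>The index is the place of the leading digit, so \<open>repunit r n\<close> and
  \<open>r ^ n\<close> have the same length \<open>n + 1\<close>.\<close>

primrec repunit :: "nat \<Rightarrow> nat \<Rightarrow> nat" where
  "repunit r 0 = 1"
| "repunit r (Suc n) = r * repunit r n + 1"

lemma power_le_repunit: "r ^ n \<le> repunit r n"
proof (induction n)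
  case (Suc n)
  then have "r * r ^ n \<le> r * repunit r n" by (rule mult_le_mono2)
  also have "\<dots> \<le> repunit r (Suc n)" by simp
  finally show ?case by simp
qed simp

lemma repunit_less_power:
  assumes "r \<ge> 2"
  shows "repunit r n < r ^ Suc n"
proof (induction n)
  case (Suc n)
  \<comment> \<open>Read as \<open>Suc (repunit r n) \<le> r ^ Suc n\<close>, the induction
    hypothesis gains a slack of \<open>r\<close> when multiplied by \<open>r\<close>, which exceeds
    the 1 appended by the recursion.\<close>
  then have "r * Suc (repunit r n) \<le> r * r ^ Suc n" by (intro mult_left_mono) auto
  then show ?case using assms by simp
qed (use assms in simp)

text \<open>Division by \<open>r\<close> strips the last 1 and leaves the next shorter repunit, so
  place \<open>k\<close> reduces to place \<open>k - 1\<close>; hence the induction on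
  \<open>n\<close> with \<open>k\<close> arbitrary.\<close>

lemma repunit_digit:
  assumes "r \<ge> 2" and "k \<le> n"
  shows "(repunit r n div r ^ k) mod r = 1"
  using assms(2)
proof (induction n arbitrary: k)
  case 0
  then show ?case using assms(1) by simp
next
  case (Suc n)
  show ?case
  proof (cases k)
    case 0
    then show ?thesis using assms(1) by (simp add: mod_Suc)
  next
    case (Suc k')
    have "repunit r (Suc n) div r = repunit r n"
      using assms(1) by (intro div_nat_eqI) auto
    then have "repunit r (Suc n) div r ^ k = repunit r n div r ^ k'"
      using Suc by (simp add: div_mult2_eq)
    then show ?thesis using Suc.IH[of k'] Suc.prems Suc by simp
  qed
qed

lemma floorlog_eq_Suc:
  assumes "r \<ge> 2" and "r ^ n \<le> x" and "x < r ^ Suc n"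
  shows "floorlog r x = Suc n"
  using assms floorlog_ge_SucI[of r n x] floorlog_leI[of x r "Suc n"] by simp

lemma digit_count_repunit:
  assumes "r \<ge> 2"
  shows "digit_count r 1 (repunit r n) = Suc n"
proof -
  have "floorlog r (repunit r n) = Suc n"
    using assms power_le_repunit repunit_less_power by (intro floorlog_eq_Suc)
  then have "{k. k < floorlog r (repunit r n) \<and> (repunit r n div r ^ k) mod r = 1} = {..<Suc n}"
    using assms repunit_digit by auto
  then show ?thesis unfolding digit_count_def by simp
qed

lemma digit_count_power:
  assumes "r \<ge> 2"
  shows "digit_count r 1 (r ^ n) = 1"
proof -
  have fl: "floorlog r (r ^ n) = Suc n"
    using assms by (intro floorlog_eq_Suc) auto
  have dig: "(r ^ n div r ^ k) mod r = (if k = n then 1 else 0)" if le: "k \<le> n" for k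
  proof (cases "k = n")
    case False
    \<comment> \<open>Below the leading place the quotient is a positive power of \<open>r\<close>,
      hence divisible by \<open>r\<close>.\<close>
    then obtain m where "n = k + Suc m"
      using le less_imp_Suc_add[of k n] by auto
    then have "r ^ n div r ^ k = r ^ Suc m" using assms by (simp add: power_add)
    then show ?thesis using False by simp
  qed (use assms in simp)
  have "k < floorlog r (r ^ n) \<and> (r ^ n div r ^ k) mod r = 1 \<longleftrightarrow> k = n" for k
    unfolding fl less_Suc_eq_le using dig[of k] by (metis order_refl zero_neq_one)
  then show ?thesis unfolding digit_count_def by (simp only:) simp
qed

definition power_repunit :: "nat \<Rightarrow> nat \<Rightarrow> nat" where
  "power_repunit r n = (if even n then r ^ n else repunit r n)"

text \<open>Both kinds of term lie in the same block of numbers with \<open>n + 1\<close> digits.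
  This yields the digit count, the monotonicity (consecutive blocks are disjoint) and the comparison
  with a geometric series.\<close>

lemma power_repunit_bounds:
  assumes "r \<ge> 2"
  shows "r ^ n \<le> power_repunit r n" and "power_repunit r n < r ^ Suc n"
  using assms power_le_repunit[of r n] repunit_less_power[of r n]
  by (simp_all add: power_repunit_def)

lemma power_repunit_pos:
  assumes "r \<ge> 2"
  shows "power_repunit r n > 0"
  using assms by (intro less_le_trans[OF zero_less_power power_repunit_bounds(1)]) auto

lemma strict_mono_power_repunit:
  assumes "r \<ge> 2"
  shows "strict_mono (power_repunit r)"
  unfolding strict_mono_Suc_iff
  by (intro allI less_le_trans[OF power_repunit_bounds(2) power_repunit_bounds(1)] assms)

lemma digit_frequency_power_repunit:
  assumes "r \<ge> 2"
  shows "real (digit_count r 1 (power_repunit r n)) / real (floorlog r (power_repunit r n))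
    = (if even n then 1 / real (Suc n) else 1)"
  using floorlog_eq_Suc[OF assms power_repunit_bounds[OF assms]]
    digit_count_power[OF assms] digit_count_repunit[OF assms]
  by (simp add: power_repunit_def)

lemma irregular_power_repunit:
  assumes "r \<ge> 2"
  shows "irregular r (power_repunit r)"
proof -
  let ?f = "\<lambda>n. real (digit_count r 1 (power_repunit r n)) / real (floorlog r (power_repunit r n))"
  have "\<not> convergent ?f"
  proof
    assume "convergent ?f"
    then obtain L where L: "?f \<longlonglongrightarrow> L" by (auto simp: convergent_def)
    \<comment> \<open>The frequencies tend to 0 along even indices and are constantly 1 along odd
      ones, so \<open>L\<close> would equal both 0 and 1.\<close>
    have even_mono: "strict_mono (\<lambda>n::nat. 2 * n)" and odd_mono: "strict_mono (\<lambda>n::nat. 2 * n + 1)"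
      by (auto simp: strict_mono_def)
    have "(\<lambda>n. 1 / real (Suc (2 * n))) \<longlonglongrightarrow> L"
      using LIMSEQ_subseq_LIMSEQ[OF L even_mono]
      by (simp only: o_def digit_frequency_power_repunit[OF assms]) simp
    moreover have "(\<lambda>n. 1 / real (Suc (2 * n))) \<longlonglongrightarrow> 0"
      using LIMSEQ_subseq_LIMSEQ[OF LIMSEQ_inverse_real_of_nat even_mono]
      by (simp add: o_def inverse_eq_divide)
    moreover have "(\<lambda>n::nat. 1) \<longlonglongrightarrow> L"
      using LIMSEQ_subseq_LIMSEQ[OF L odd_mono]
      by (simp only: o_def digit_frequency_power_repunit[OF assms]) simp
    ultimately show False
      using LIMSEQ_unique[of _ L 0] LIMSEQ_const_iff[of 1 L] by (metis zero_neq_one)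
  qed
  then show ?thesis
    using assms strict_mono_power_repunit power_repunit_pos by (force simp: irregular_def)
qed

lemma summable_power_repunit:
  assumes "r \<ge> 2"
  shows "summable (\<lambda>n. 1 / real (power_repunit r n))"
proof (rule summable_comparison_test')
  show "summable (\<lambda>n. (1 / real r) ^ n)" using assms by (intro summable_geometric) simp
  show "norm (1 / real (power_repunit r n)) \<le> (1 / real r) ^ n" for n
  proof -
    have "real r ^ n \<le> real (power_repunit r n)"
      using power_repunit_bounds(1)[OF assms, of n] by (metis of_nat_le_iff of_nat_power)
    then show ?thesis using assms by (simp add: power_one_over frac_le)
  qed
qed

text \<open>\<open>Suc\<close> enumerates all positive integers from index 0, so \<open>v n\<close>
  sits at index \<open>v n - 1\<close>, and a limit for the full sequence would pass to this
  subsequence with the same digit \<open>j\<close>.\<close>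

lemma irregular_Suc_if_irregular:
  assumes "irregular r v"
  shows "irregular r Suc"
proof -
  obtain j where v: "strict_mono v" "\<And>n. v n > 0" and j: "j \<in> {1..r - 1}"
    and nc: "\<not> convergent (\<lambda>n. real (digit_count r j (v n)) / real (floorlog r (v n)))"
    using assms unfolding irregular_def by blast
  let ?g = "\<lambda>n. real (digit_count r j (Suc n)) / real (floorlog r (Suc n))"
  have "strict_mono (\<lambda>n. v n - 1)"
    \<comment> \<open>Positivity of \<open>v\<close> keeps the truncated subtraction strictly
      monotone.\<close>
    using v by (auto simp: strict_mono_def intro!: diff_less_mono Suc_leI)
  then have "convergent ?g \<Longrightarrow> convergent (?g \<circ> (\<lambda>n. v n - 1))"
    using convergent_subseq_convergent by blast
  then have "\<not> convergent ?g" using nc v(2) by (auto simp: o_def)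
  then show ?thesis using j by (auto simp: irregular_def strict_mono_def)
qed

lemma sum_inverse_Suc_at_top:
  "filterlim (\<lambda>N. \<Sum>n<N. 1 / real (Suc n)) at_top sequentially"
proof -
  \<comment> \<open>The sum over \<open>n < N\<close> of shifted reciprocals runs over denominators
    1 to \<open>N\<close>, so divergence is that of the harmonic numbers.\<close>
  have "(\<Sum>n<N. 1 / real (Suc n)) = harm N" for N
    by (induction N) (simp_all add: harm_Suc inverse_eq_divide harm_def)
  then show ?thesis using harm_at_top by simp
qed

theorem theorem7:
  fixes r :: nat
  assumes "r \<ge> 2"
  shows "(\<exists>v. irregular r v) \<and>
    (r > 2 \<longrightarrow>
      (\<exists>v. irregular r v \<and> summable (\<lambda>n. 1 / real (v n))) \<and>
      (\<exists>v. irregular r v \<and>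
         filterlim (\<lambda>N. \<Sum>n<N. 1 / real (v n)) at_top sequentially))"
proof -
  have irr: "irregular r (power_repunit r)" using assms by (rule irregular_power_repunit)
  moreover have "summable (\<lambda>n. 1 / real (power_repunit r n))"
    using assms by (rule summable_power_repunit)
  moreover have "irregular r Suc" using irr by (rule irregular_Suc_if_irregular)
  moreover note sum_inverse_Suc_at_top
  ultimately show ?thesis by (intro conjI impI exI)
qed

end
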